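(* Let $\beta,\mu>0$ and let $n_s,n_t\in\mathbb N$ with $n_s\ge n_t$. Set $h_s=\beta/n_s$, $h_t=2\mu/n_t$, and define $s_i=h_s i$ for $i=0,\ldots,n_s$ and $t_j=-\mu+h_t j$ for $j=0,\ldots,n_t$. Let $\boldsymbol R\in\mathbb R^{(n_s+1)\times(n_t+1)}$ be the matrix with entries $R_{i,j}=\exp(-s_it_j)$, and set $$q=\left\lfloor\frac{n_s+1}{n_t+1}\right\rfloor.$$ Then the condition number of $\boldsymbol R$ satisfies $$\frac{1}{\sqrt2\,n_t^{1/4}}\left(\frac{n_t}{\beta\mu}\right)^{n_t}\le\kappa(\boldsymbol R)\le\sqrt{\frac{(n_t+1)(n_s+1)}{q}}\,\exp(3\beta\mu)\left(\frac{2e\,n_s}{\beta\mu q}\right)^{n_t}.$$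
   Context: $\mathbb N$ denotes the positive integers. For a real rectangular matrix $\boldsymbol R$ with at least as many rows as columns, $\kappa(\boldsymbol R)$ is the spectral-norm condition number $\kappa(\boldsymbol R)=\sqrt{\lambda_{\max}(\boldsymbol R^\top\boldsymbol R)/\lambda_{\min}(\boldsymbol R^\top\boldsymbol R)}$, i.e. the ratio of the largest to the smallest singular value. $e$ is Euler's number. *)

theory Defs
  imports Complex_Main "Jordan_Normal_Form.Spectral_Radius"
begin

(* Intended for real matrices with at least one column and at least as many rows as columns, for
   which spectrum (R\<^sup>T R) is a nonempty finite set of nonnegative reals.
   If R does not have full column rank, the usual value is infinity; here x / 0 = 0 gives 0,
   so any positive lower bound on the value also certifies full column rank. *)
definition condition_number :: "real mat \<Rightarrow> real" where
  "condition_number R =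
     sqrt (Max (spectrum (transpose_mat R * R)) / Min (spectrum (transpose_mat R * R)))"

end

theory Submission
  imports Defs
begin

text \<open>Both inequalities compare Rayleigh quotients of \<open>R\<^sup>T R\<close>. For the lower bound, the alternating
  binomial vector \<open>w\<close> turns row \<open>i\<close> of \<open>R\<close> into the \<open>n\<^sub>t\<close>-th finite difference
  \<open>exp (s\<^sub>i \<mu>) (1 - exp (- s\<^sub>i h\<^sub>t))^n\<^sub>t\<close>, which is at most \<open>(2 \<beta> \<mu> / n\<^sub>t)^n\<^sub>t\<close> times the corresponding
  entry of the first column, while \<open>w\<close> has squared norm \<open>(2 n\<^sub>t) choose n\<^sub>t\<close>. For the upper bound, the largest
  singular value is controlled by the size of the entries; for the smallest one, the rows
  \<open>k, k + q, \<dots>, k + q n\<^sub>t\<close> form, for each \<open>k < q\<close>, a Vandermonde matrix with geometric nodes up to a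
  diagonal factor, and its inverse is bounded through the coefficients of the Lagrange polynomials.
  The \<open>q\<close> disjoint row groups contribute the factor \<open>q\<close>.\<close>

section \<open>Rayleigh quotients and the condition number\<close>

text \<open>The inequality 2 |v_i v_j| \<le> v_i^2 + v_j^2 removes the mixed terms, and summing over
  the pairs counts every square 2n times. The resulting crude bound is the only estimate of the
  largest singular value that is made.\<close>

lemma quadratic_form_le:
  fixes B :: "real mat"
  assumes B: "B \<in> carrier_mat n n" and v: "v \<in> carrier_vec n"
    and M: "\<And>i j. i < n \<Longrightarrow> j < n \<Longrightarrow> \<bar>B $$ (i, j)\<bar> \<le> M"
  shows "v \<bullet> (B *\<^sub>v v) \<le> M * real n * (v \<bullet> v)"
proof -
  have "v \<bullet> (B *\<^sub>v v) = (\<Sum>i<n. \<Sum>j<n. v $ i * (B $$ (i, j) * v $ j))"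
    using B v by (auto simp: scalar_prod_def sum_distrib_left atLeast0LessThan intro!: sum.cong)
  also have "\<dots> \<le> (\<Sum>i<n. \<Sum>j<n. M / 2 * ((v $ i)\<^sup>2 + (v $ j)\<^sup>2))"
  proof (intro sum_mono)
    fix i j assume "i \<in> {..<n}" "j \<in> {..<n}"
    hence b: "\<bar>B $$ (i, j)\<bar> \<le> M" using M by auto
    have "v $ i * (B $$ (i, j) * v $ j) \<le> \<bar>B $$ (i, j)\<bar> * (\<bar>v $ i\<bar> * \<bar>v $ j\<bar>)"
      by (metis abs_ge_self abs_mult mult.left_commute)
    also have "\<dots> \<le> M * (\<bar>v $ i\<bar> * \<bar>v $ j\<bar>)"
      using b by (intro mult_right_mono) auto
    also have "\<dots> \<le> M * (((v $ i)\<^sup>2 + (v $ j)\<^sup>2) / 2)"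
    proof (rule mult_left_mono)
      have "0 \<le> (\<bar>v $ i\<bar> - \<bar>v $ j\<bar>)\<^sup>2" by simp
      thus "\<bar>v $ i\<bar> * \<bar>v $ j\<bar> \<le> ((v $ i)\<^sup>2 + (v $ j)\<^sup>2) / 2"
        by (simp add: power2_diff)
    qed (use b in auto)
    finally show "v $ i * (B $$ (i, j) * v $ j) \<le> M / 2 * ((v $ i)\<^sup>2 + (v $ j)\<^sup>2)" by simp
  qed
  also have "\<dots> = M * real n * (\<Sum>i<n. (v $ i)\<^sup>2)"
  proof -
    have "(\<Sum>i<n. \<Sum>j<n. M / 2 * ((v $ i)\<^sup>2 + (v $ j)\<^sup>2))
        = M / 2 * (\<Sum>i<n. \<Sum>j<n. (v $ i)\<^sup>2 + (v $ j)\<^sup>2)"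
      by (simp only: sum_distrib_left)
    also have "(\<Sum>i<n. \<Sum>j<n. (v $ i)\<^sup>2 + (v $ j)\<^sup>2) = 2 * real n * (\<Sum>i<n. (v $ i)\<^sup>2)"
      by (simp add: sum.distrib sum_distrib_left[symmetric])
    finally show ?thesis by simp
  qed
  also have "(\<Sum>i<n. (v $ i)\<^sup>2) = v \<bullet> v"
    using v by (simp add: scalar_prod_def power2_eq_square atLeast0LessThan)
  finally show ?thesis .
qed

lemma quadratic_form_bounded:
  fixes B :: "real mat"
  assumes B: "B \<in> carrier_mat n n"
  obtains K where "0 < K" and "\<And>v. v \<in> carrier_vec n \<Longrightarrow> v \<bullet> (B *\<^sub>v v) \<le> K * (v \<bullet> v)"
proof -
  define M where "M = (\<Sum>i<n. \<Sum>j<n. \<bar>B $$ (i, j)\<bar>)"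
  have M: "\<bar>B $$ (i, j)\<bar> \<le> M" if "i < n" "j < n" for i j
  proof -
    have "\<bar>B $$ (i, j)\<bar> \<le> (\<Sum>j<n. \<bar>B $$ (i, j)\<bar>)"
      using that by (intro member_le_sum) auto
    also have "\<dots> \<le> M" unfolding M_def
      using that by (intro member_le_sum[of i _ "\<lambda>i. \<Sum>j<n. \<bar>B $$ (i, j)\<bar>"]) (auto intro: sum_nonneg)
    finally show ?thesis .
  qed
  have M0: "0 \<le> M" unfolding M_def by (intro sum_nonneg) auto
  \<comment> \<open>The summand 1 keeps the bound strictly positive even for the zero matrix; its
    reciprocal is used later.\<close>
  show thesis
  proof (rule that[of "M * real n + 1"])
    show "0 < M * real n + 1" using M0 by (simp add: add_nonneg_pos)
    fix v :: "real vec" assume v: "v \<in> carrier_vec n"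
    have "0 \<le> v \<bullet> v" by (simp add: scalar_prod_def sum_nonneg)
    with quadratic_form_le[OF B v M] show "v \<bullet> (B *\<^sub>v v) \<le> (M * real n + 1) * (v \<bullet> v)"
      by (simp add: algebra_simps)
  qed
qed

lemma scalar_prod_self_pos:
  fixes v :: "real vec"
  assumes v: "v \<in> carrier_vec n" and "v \<noteq> 0\<^sub>v n"
  shows "0 < v \<bullet> v"
proof -
  have "\<exists>i<n. v $ i \<noteq> 0"
  proof (rule ccontr)
    assume "\<not> (\<exists>i<n. v $ i \<noteq> 0)"
    hence "v = 0\<^sub>v n" using v by (intro eq_vecI) auto
    with assms show False by blast
  qed
  then obtain i where i: "i < n" "v $ i \<noteq> 0" by blast
  have "v \<bullet> v = (\<Sum>i<n. v $ i * v $ i)"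
    using v by (simp add: scalar_prod_def atLeast0LessThan)
  also have "\<dots> > 0" using i by (intro sum_pos2[of _ i]) (auto simp: zero_less_mult_iff)
  finally show ?thesis .
qed

lemma eigenvalue_quadratic_form:
  fixes A :: "real mat"
  assumes A: "A \<in> carrier_mat n n" and "eigenvalue A k"
  obtains v where "v \<in> carrier_vec n" "0 < v \<bullet> v" "v \<bullet> (A *\<^sub>v v) = k * (v \<bullet> v)"
proof -
  from assms obtain v where v: "v \<in> carrier_vec n" "v \<noteq> 0\<^sub>v n" "A *\<^sub>v v = k \<cdot>\<^sub>v v"
    by (auto simp: eigenvalue_def eigenvector_def)
  with scalar_prod_self_pos[OF v(1,2)] show thesis by (intro that[of v]) auto
qed

text \<open>If the infimum \<open>c\<close> of the Rayleigh quotient were not an eigenvalue, \<open>B = A - c I\<close> would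
  have an inverse \<open>C\<close>; expanding \<open>0 \<le> (C v - K v) \<bullet> B (C v - K v)\<close> for a bound \<open>K\<close> of the form of
  \<open>C\<close> shows \<open>v \<bullet> B v \<ge> 1 / K\<close> on the unit sphere. No compactness is needed.\<close>

lemma symmetric_eigenvalue_le_quadratic_form:
  fixes A :: "real mat"
  assumes A: "A \<in> carrier_mat n n" and sym: "transpose_mat A = A" and n: "0 < n"
  obtains c where "eigenvalue A c"
    and "\<And>v. v \<in> carrier_vec n \<Longrightarrow> c * (v \<bullet> v) \<le> v \<bullet> (A *\<^sub>v v)"
proof -
  define S where "S = {v \<bullet> (A *\<^sub>v v) | v. v \<in> carrier_vec n \<and> v \<bullet> v = 1}"
  define c where "c = Inf S"
  have nonempty: "S \<noteq> {}"
  proof -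
    have "unit_vec n 0 \<in> carrier_vec n" "unit_vec n 0 \<bullet> unit_vec n 0 = (1::real)"
      using n by auto
    thus ?thesis unfolding S_def by blast
  qed
  have "bdd_below S"
  proof -
    \<comment> \<open>An upper bound for the form of \<open>- A\<close> is a lower bound for the
      form of \<open>A\<close>.\<close>
    obtain K where K: "\<And>v. v \<in> carrier_vec n \<Longrightarrow> v \<bullet> ((- A) *\<^sub>v v) \<le> K * (v \<bullet> v)"
      using quadratic_form_bounded[of "- A" n] A by auto
    have "- K \<le> v \<bullet> (A *\<^sub>v v)" if "v \<in> carrier_vec n" "v \<bullet> v = 1" for v
      using K[OF that(1)] that A by auto
    thus ?thesis unfolding S_def bdd_below_def by blast
  qed
  have le: "c * (v \<bullet> v) \<le> v \<bullet> (A *\<^sub>v v)" if v: "v \<in> carrier_vec n" for v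
  proof (cases "v = 0\<^sub>v n")
    case True
    thus ?thesis using A by auto
  next
    case False
    define r where "r = v \<bullet> v"
    have r: "0 < r" unfolding r_def by (rule scalar_prod_self_pos[OF v False])
    define w where "w = (1 / sqrt r) \<cdot>\<^sub>v v"
    have w: "w \<in> carrier_vec n" unfolding w_def using v by simp
    have ww: "w \<bullet> w = 1" unfolding w_def using v r by (simp add: r_def[symmetric])
    have Aw: "w \<bullet> (A *\<^sub>v w) = (v \<bullet> (A *\<^sub>v v)) / r"
      unfolding w_def using v r A by (simp add: mult_mat_vec[OF A v])
    have "w \<bullet> (A *\<^sub>v w) \<in> S" unfolding S_def using w ww by blast
    hence "c \<le> w \<bullet> (A *\<^sub>v w)" unfolding c_def using \<open>bdd_below S\<close> by (rule cInf_lower)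
    thus ?thesis unfolding Aw using r by (simp add: field_simps r_def)
  qed
  have "eigenvalue A c"
  proof (rule ccontr)
    assume "\<not> eigenvalue A c"
    define B where "B = char_matrix A c"
    have B: "B \<in> carrier_mat n n" unfolding B_def using A by auto
    have Bv: "B *\<^sub>v v = A *\<^sub>v v - c \<cdot>\<^sub>v v" if v: "v \<in> carrier_vec n" for v
      unfolding B_def char_matrix_def using A v
      by (auto simp: add_mult_distrib_mat_vec[OF A] intro!: eq_vecI)
    have vBv: "v \<bullet> (B *\<^sub>v v) = v \<bullet> (A *\<^sub>v v) - c * (v \<bullet> v)" if v: "v \<in> carrier_vec n" for v
      using A v by (simp add: Bv scalar_prod_minus_distrib[of v n])
    have symB: "transpose_mat B = B"
    proof (rule eq_matI)
      fix i j assume ij: "i < dim_row B" "j < dim_col B"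
      have "A $$ (i, j) = transpose_mat A $$ (i, j)" using sym by simp
      with ij B A show "transpose_mat B $$ (i, j) = B $$ (i, j)"
        unfolding B_def char_matrix_def by auto
    qed (use B in auto)
    have "det B \<noteq> 0" using \<open>\<not> eigenvalue A c\<close> eigenvalue_det[OF A] B_def by simp
    from det_non_zero_imp_unit[OF B this]
    obtain C where C: "C \<in> carrier_mat n n" and BC: "B * C = 1\<^sub>m n"
      unfolding Units_def by (auto simp: ring_mat_def)
    obtain K where K0: "0 < K" and K: "\<And>v. v \<in> carrier_vec n \<Longrightarrow> v \<bullet> (C *\<^sub>v v) \<le> K * (v \<bullet> v)"
      using quadratic_form_bounded[OF C] by blast
    have "c + 1 / K \<le> v \<bullet> (A *\<^sub>v v)" if v: "v \<in> carrier_vec n" and vv: "v \<bullet> v = 1" for v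
    proof -
      define u where "u = C *\<^sub>v v"
      have u: "u \<in> carrier_vec n" unfolding u_def using C v by auto
      have Bu: "B *\<^sub>v u = v" unfolding u_def
        using assoc_mult_mat_vec[OF B C v] BC v by simp
      define w where "w = u - K \<cdot>\<^sub>v v"
      have w: "w \<in> carrier_vec n" unfolding w_def using u v by auto
      have Bw: "B *\<^sub>v w = v - K \<cdot>\<^sub>v (B *\<^sub>v v)"
        unfolding w_def using B u v
        by (subst mult_minus_distrib_mat_vec[OF B u]) (auto simp: Bu mult_mat_vec[OF B v])
      \<comment> \<open>Symmetry moves \<open>B\<close> onto \<open>u\<close>, where it gives back
        \<open>v\<close>; the value is v . v = 1.\<close>
      have uBv: "u \<bullet> (B *\<^sub>v v) = 1"
        using transpose_vec_mult_scalar[OF B v u] symB Bu vv by simp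
      have cBv: "B *\<^sub>v v \<in> carrier_vec n" using B v by auto
      have "0 \<le> w \<bullet> (B *\<^sub>v w)" using le[OF w] vBv[OF w] by simp
      also have "w \<bullet> (B *\<^sub>v w) = u \<bullet> v - 2 * K + K\<^sup>2 * (v \<bullet> (B *\<^sub>v v))"
        unfolding Bw unfolding w_def using u v cBv vv uBv
        by (simp add: minus_scalar_prod_distrib[of _ n] scalar_prod_minus_distrib[of _ n]
            power2_eq_square algebra_simps)
      also have "u \<bullet> v \<le> K" using K[OF v] comm_scalar_prod[OF u v] vv unfolding u_def by simp
      finally have "K * 1 \<le> K * (K * (v \<bullet> (B *\<^sub>v v)))" by (simp add: power2_eq_square mult.assoc)
      hence "1 \<le> K * (v \<bullet> (B *\<^sub>v v))" using K0 by simp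
      hence "1 / K \<le> v \<bullet> (B *\<^sub>v v)" using K0 by (simp add: field_simps)
      thus ?thesis using vBv[OF v] vv by simp
    qed
    \<comment> \<open>A lower bound for all of \<open>S\<close> that exceeds its infimum is the
      contradiction.\<close>
    hence "c + 1 / K \<le> Inf S" using nonempty by (intro cInf_greatest) (auto simp: S_def)
    thus False using K0 unfolding c_def by simp
  qed
  with le show thesis by (intro that)
qed

text \<open>Negation exchanges the two ends of the spectrum: the least Rayleigh quotient of
  \<open>- A\<close>, negated, is the greatest one of \<open>A\<close>.\<close>

lemma symmetric_quadratic_form_le_eigenvalue:
  fixes A :: "real mat"
  assumes A: "A \<in> carrier_mat n n" and sym: "transpose_mat A = A" and n: "0 < n"
  obtains c where "eigenvalue A c"
    and "\<And>v. v \<in> carrier_vec n \<Longrightarrow> v \<bullet> (A *\<^sub>v v) \<le> c * (v \<bullet> v)"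
proof -
  have symneg: "transpose_mat (- A) = - A"
  proof (rule eq_matI)
    fix i j assume ij: "i < dim_row (- A)" "j < dim_col (- A)"
    have "A $$ (i, j) = transpose_mat A $$ (i, j)" using sym by simp
    with ij A show "transpose_mat (- A) $$ (i, j) = (- A) $$ (i, j)" by auto
  qed (use A in auto)
  have neg: "(- A) *\<^sub>v v = - (A *\<^sub>v v)" if "v \<in> carrier_vec n" for v
    using A that by auto
  obtain c where c: "eigenvalue (- A) c"
    and le: "\<And>v. v \<in> carrier_vec n \<Longrightarrow> c * (v \<bullet> v) \<le> v \<bullet> ((- A) *\<^sub>v v)"
    using symmetric_eigenvalue_le_quadratic_form[OF _ symneg n] A by auto
  show thesis
  proof (rule that[of "- c"])
    from c obtain v where v: "v \<in> carrier_vec n" "v \<noteq> 0\<^sub>v n" and e: "(- A) *\<^sub>v v = c \<cdot>\<^sub>v v"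
      using A by (auto simp: eigenvalue_def eigenvector_def)
    have "A *\<^sub>v v = - (- (A *\<^sub>v v))" by simp
    also have "\<dots> = - (c \<cdot>\<^sub>v v)" using e neg[OF v(1)] by simp
    also have "\<dots> = (- c) \<cdot>\<^sub>v v" using v by (intro eq_vecI) auto
    finally show "eigenvalue A (- c)" using v A by (auto simp: eigenvalue_def eigenvector_def)
  next
    fix v :: "real vec" assume v: "v \<in> carrier_vec n"
    show "v \<bullet> (A *\<^sub>v v) \<le> - c * (v \<bullet> v)" using le[OF v] A v by auto
  qed
qed

lemma gram_quadratic_form:
  fixes R :: "real mat"
  assumes R: "R \<in> carrier_mat m n" and v: "v \<in> carrier_vec n"
  shows "v \<bullet> ((transpose_mat R * R) *\<^sub>v v) = (R *\<^sub>v v) \<bullet> (R *\<^sub>v v)"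
proof -
  have RT: "transpose_mat R \<in> carrier_mat n m" and Rv: "R *\<^sub>v v \<in> carrier_vec m"
    using R v by auto
  have "v \<bullet> ((transpose_mat R * R) *\<^sub>v v) = v \<bullet> (transpose_mat R *\<^sub>v (R *\<^sub>v v))"
    using assoc_mult_mat_vec[OF RT R v] by simp
  also have "\<dots> = (transpose_mat R *\<^sub>v (R *\<^sub>v v)) \<bullet> v"
    using RT Rv v by (intro comm_scalar_prod[of _ n]) auto
  also have "\<dots> = (R *\<^sub>v v) \<bullet> (R *\<^sub>v v)"
    using transpose_vec_mult_scalar[OF R v Rv] by simp
  finally show ?thesis .
qed

text \<open>R^T R is symmetric, so its form |R v|^2 is bounded on each side by some eigenvalue, and
  \<open>Min\<close> and \<open>Max\<close> are at least as extreme as these. The last clause serves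
  the converse direction: any bound on all Rayleigh quotients is inherited by the eigenvalues,
  because each is attained at an eigenvector.\<close>

lemma gram_spectrum:
  fixes R :: "real mat"
  assumes R: "R \<in> carrier_mat m n" and n: "0 < n"
  defines "\<Lambda> \<equiv> spectrum (transpose_mat R * R)"
  shows "finite \<Lambda>" and "\<Lambda> \<noteq> {}"
    and "\<And>v. v \<in> carrier_vec n \<Longrightarrow> Min \<Lambda> * (v \<bullet> v) \<le> (R *\<^sub>v v) \<bullet> (R *\<^sub>v v)"
    and "\<And>v. v \<in> carrier_vec n \<Longrightarrow> (R *\<^sub>v v) \<bullet> (R *\<^sub>v v) \<le> Max \<Lambda> * (v \<bullet> v)"
    and "\<And>k. k \<in> \<Lambda> \<Longrightarrow> \<exists>v\<in>carrier_vec n. 0 < v \<bullet> v \<and> (R *\<^sub>v v) \<bullet> (R *\<^sub>v v) = k * (v \<bullet> v)"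
proof -
  let ?A = "transpose_mat R * R"
  have A: "?A \<in> carrier_mat n n" using R by auto
  have sym: "transpose_mat ?A = ?A"
    using R by (simp add: transpose_mult[of _ n m _ n])
  have nonneg: "0 \<le> v \<bullet> v" for v :: "real vec" by (simp add: scalar_prod_def sum_nonneg)
  show fin: "finite \<Lambda>" unfolding \<Lambda>_def by (rule card_finite_spectrum(1)[OF A])
  obtain c where c: "c \<in> \<Lambda>"
    and cle: "\<And>v. v \<in> carrier_vec n \<Longrightarrow> c * (v \<bullet> v) \<le> v \<bullet> (?A *\<^sub>v v)"
    using symmetric_eigenvalue_le_quadratic_form[OF A sym n]
    by (auto simp: \<Lambda>_def spectrum_def)
  obtain d where d: "d \<in> \<Lambda>"
    and dle: "\<And>v. v \<in> carrier_vec n \<Longrightarrow> v \<bullet> (?A *\<^sub>v v) \<le> d * (v \<bullet> v)"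
    using symmetric_quadratic_form_le_eigenvalue[OF A sym n]
    by (auto simp: \<Lambda>_def spectrum_def)
  show "\<Lambda> \<noteq> {}" using c by blast
  show "Min \<Lambda> * (v \<bullet> v) \<le> (R *\<^sub>v v) \<bullet> (R *\<^sub>v v)" if v: "v \<in> carrier_vec n" for v
    using mult_right_mono[OF Min_le[OF fin c] nonneg[of v]] cle[OF v] gram_quadratic_form[OF R v]
    by linarith
  show "(R *\<^sub>v v) \<bullet> (R *\<^sub>v v) \<le> Max \<Lambda> * (v \<bullet> v)" if v: "v \<in> carrier_vec n" for v
    using mult_right_mono[OF Max_ge[OF fin d] nonneg[of v]] dle[OF v] gram_quadratic_form[OF R v]
    by linarith
  show "\<exists>v\<in>carrier_vec n. 0 < v \<bullet> v \<and> (R *\<^sub>v v) \<bullet> (R *\<^sub>v v) = k * (v \<bullet> v)" if "k \<in> \<Lambda>" for k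
  proof -
    have "eigenvalue ?A k" using that by (simp add: \<Lambda>_def spectrum_def)
    from eigenvalue_quadratic_form[OF A this] show ?thesis
      using gram_quadratic_form[OF R] by metis
  qed
qed

text \<open>An upper estimate of the condition number requires control of |R v| for all
  \<open>v\<close>. A lower estimate only requires two trial vectors: \<open>v\<close> bounds the
  largest eigenvalue from below, \<open>w\<close> bounds the smallest from above.\<close>

lemma condition_number_bounds:
  fixes R :: "real mat"
  assumes R: "R \<in> carrier_mat m n" and n: "0 < n" and l: "0 < l"
    and lower: "\<And>v. v \<in> carrier_vec n \<Longrightarrow> l * (v \<bullet> v) \<le> (R *\<^sub>v v) \<bullet> (R *\<^sub>v v)"
  shows condition_number_le:
      "(\<And>v. v \<in> carrier_vec n \<Longrightarrow> (R *\<^sub>v v) \<bullet> (R *\<^sub>v v) \<le> L * (v \<bullet> v)) \<Longrightarrow>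
        condition_number R \<le> sqrt (L / l)"
    and condition_number_ge:
      "v \<in> carrier_vec n \<Longrightarrow> 0 \<le> b \<Longrightarrow> b * (v \<bullet> v) \<le> (R *\<^sub>v v) \<bullet> (R *\<^sub>v v) \<Longrightarrow> 0 < v \<bullet> v \<Longrightarrow>
       w \<in> carrier_vec n \<Longrightarrow> 0 < a \<Longrightarrow> (R *\<^sub>v w) \<bullet> (R *\<^sub>v w) \<le> a * (w \<bullet> w) \<Longrightarrow> 0 < w \<bullet> w \<Longrightarrow>
        sqrt (b / a) \<le> condition_number R"
proof -
  define \<Lambda> where "\<Lambda> = spectrum (transpose_mat R * R)"
  note spec = gram_spectrum[OF R n, folded \<Lambda>_def]
  have cond: "condition_number R = sqrt (Max \<Lambda> / Min \<Lambda>)"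
    by (simp add: condition_number_def \<Lambda>_def)
  \<comment> \<open>Positivity of \<open>l\<close> rules out a zero denominator, where the
    convention x / 0 = 0 would apply.\<close>
  have Min: "l \<le> Min \<Lambda>"
  proof -
    from spec(5)[OF Min_in[OF spec(1,2)]] obtain v where v: "v \<in> carrier_vec n"
      and "0 < v \<bullet> v" "(R *\<^sub>v v) \<bullet> (R *\<^sub>v v) = Min \<Lambda> * (v \<bullet> v)" by blast
    with lower[OF v] show ?thesis by simp
  qed
  hence Max: "0 < Max \<Lambda>" using l Min_le[OF spec(1) Max_in[OF spec(1,2)]] by linarith
  { assume upper: "\<And>v. v \<in> carrier_vec n \<Longrightarrow> (R *\<^sub>v v) \<bullet> (R *\<^sub>v v) \<le> L * (v \<bullet> v)"
    from spec(5)[OF Max_in[OF spec(1,2)]] obtain v where v: "v \<in> carrier_vec n"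
      and "0 < v \<bullet> v" "(R *\<^sub>v v) \<bullet> (R *\<^sub>v v) = Max \<Lambda> * (v \<bullet> v)" by blast
    with upper[OF v] have "Max \<Lambda> \<le> L" by simp
    thus "condition_number R \<le> sqrt (L / l)"
      unfolding cond using Min Max l by (intro real_sqrt_le_mono frac_le) auto }
  { assume v: "v \<in> carrier_vec n" "0 < v \<bullet> v" and b: "0 \<le> b" "b * (v \<bullet> v) \<le> (R *\<^sub>v v) \<bullet> (R *\<^sub>v v)"
      and w: "w \<in> carrier_vec n" "0 < w \<bullet> w" and a: "0 < a" "(R *\<^sub>v w) \<bullet> (R *\<^sub>v w) \<le> a * (w \<bullet> w)"
    have "b * (v \<bullet> v) \<le> Max \<Lambda> * (v \<bullet> v)" using b spec(4)[OF v(1)] by linarith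
    hence "b \<le> Max \<Lambda>" using v(2) by simp
    moreover have "Min \<Lambda> * (w \<bullet> w) \<le> a * (w \<bullet> w)" using a spec(3)[OF w(1)] by linarith
    hence "Min \<Lambda> \<le> a" using w(2) by simp
    ultimately show "sqrt (b / a) \<le> condition_number R"
      unfolding cond using Min l b(1) Max by (intro real_sqrt_le_mono frac_le) auto }
qed

section \<open>Inverse bounds for Vandermonde systems\<close>

text \<open>Induction on the ratio of successive terms: the binomial grows by 2 (2n + 1) / (n + 1),
  the bound by 4 sqrt n / sqrt (n + 1), and the former is at least the latter by the
  arithmetic-geometric mean inequality for n and n + 1.\<close>

lemma central_binomial_ge:
  assumes "0 < n"
  shows "4 ^ n / (2 * sqrt (real n)) \<le> real ((2 * n) choose n)"
  using assms
proof (induction n rule: nat_induct_non_zero)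
  case 1
  show ?case by simp
next
  case (Suc n)
  have rec: "real ((2 * Suc n) choose Suc n) = 2 * (2 * real n + 1) / (real n + 1) * real ((2 * n) choose n)"
  proof -
    have binom: "real ((2 * m) choose m) = fact (2 * m) / (fact m * fact m)" for m
      using binomial_fact[of m "2 * m", where 'a = real] by simp
    have num: "fact (2 * Suc n) = 2 * (real n + 1) * (2 * real n + 1) * fact (2 * n)"
      by (simp add: algebra_simps)
    have den: "fact (Suc n) = (real n + 1) * fact n" by simp
    have "2 * r * y * F / (r * f * (r * f)) = 2 * y / r * (F / (f * f))"
      if "r \<noteq> 0" "f \<noteq> 0" for r y f F :: real
      using that by (simp add: field_simps)
    from this[of "real n + 1" "fact n"] show ?thesis unfolding binom num den by simp
  qed
  have amgm: "2 * (sqrt (real n) * sqrt (real n + 1)) \<le> 2 * real n + 1"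
    using arith_geo_mean_sqrt[of "real n" "real n + 1"] by (simp add: real_sqrt_mult)
  have pos: "0 < sqrt (real n)" using Suc by simp
  have sq: "sqrt (real n + 1) * sqrt (real n + 1) = real n + 1" by simp
  have "4 ^ Suc n / (2 * sqrt (real (Suc n)))
      = 4 ^ n / (2 * sqrt (real n)) * (2 * (2 * (sqrt (real n) * sqrt (real n + 1))) / (sqrt (real n + 1) * sqrt (real n + 1)))"
    using pos by (simp add: field_simps del: real_sqrt_mult_self)
  also have "\<dots> \<le> 4 ^ n / (2 * sqrt (real n)) * (2 * (2 * real n + 1) / (real n + 1))"
    unfolding sq using amgm pos by (intro mult_left_mono divide_right_mono) auto
  also have "\<dots> \<le> real ((2 * n) choose n) * (2 * (2 * real n + 1) / (real n + 1))"
    using Suc by (intro mult_right_mono) auto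
  finally show ?case unfolding rec by (simp add: mult.commute)
qed

text \<open>n^n / n! is a single term of the exponential series for e^n.\<close>

lemma power_self_le_fact_exp: "real n ^ n \<le> fact n * exp 1 ^ n"
proof -
  have "(\<Sum>k\<in>{n}. real n ^ k /\<^sub>R fact k) \<le> exp (real n)"
    unfolding exp_def by (intro sum_le_suminf summable_exp_generic) auto
  moreover have "exp (real n) = exp 1 ^ n" by (simp add: exp_of_nat_mult[symmetric])
  ultimately show ?thesis by (simp add: field_simps)
qed

text \<open>Denominator of a Lagrange polynomial at equally spaced nodes: the distances to the left
  of \<open>j\<close> run through 1, ..., j, those to the right through 1, ..., n - j.\<close>

lemma prod_diff_fact:
  assumes "j \<le> n"
  shows "(\<Prod>m\<in>{..n} - {j}. \<bar>real j - real m\<bar>) = fact j * fact (n - j)"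
proof -
  have split: "{..n} - {j} = {..<j} \<union> {j<..n}" using assms by auto
  have "(\<Prod>m\<in>{..<j}. \<bar>real j - real m\<bar>) = (\<Prod>m<j. real (Suc m))"
    by (rule prod.reindex_bij_witness[of _ "\<lambda>m. j - Suc m" "\<lambda>m. j - Suc m"]) auto
  moreover have "(\<Prod>m\<in>{j<..n}. \<bar>real j - real m\<bar>) = (\<Prod>m<n - j. real (Suc m))"
    by (rule prod.reindex_bij_witness[of _ "\<lambda>m. j + Suc m" "\<lambda>m. m - Suc j"]) auto
  moreover have "(\<Prod>m<k. real (Suc m)) = fact k" for k by (induction k) auto
  ultimately show ?thesis unfolding split by (subst prod.union_disjoint) auto
qed

text \<open>Multiplying a polynomial by z - a enlarges the sum of the absolute values of its
  coefficients by at most the factor 1 + |a|.\<close>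

lemma prod_linear_coeffs:
  fixes x :: "'a \<Rightarrow> real"
  assumes "finite S"
  obtains c where "\<And>z. (\<Sum>l\<le>card S. c l * z ^ l) = (\<Prod>m\<in>S. z - x m)"
    and "(\<Sum>l\<le>card S. \<bar>c l\<bar>) \<le> (\<Prod>m\<in>S. 1 + \<bar>x m\<bar>)"
proof -
  from assms have "\<exists>c. (\<forall>z. (\<Sum>l\<le>card S. c l * z ^ l) = (\<Prod>m\<in>S. z - x m)) \<and>
      (\<Sum>l\<le>card S. \<bar>c l\<bar>) \<le> (\<Prod>m\<in>S. 1 + \<bar>x m\<bar>)"
  proof (induction S rule: finite_induct)
    case empty
    show ?case by (intro exI[of _ "\<lambda>_. 1"]) simp
  next
    case (insert a S)
    then obtain c where c: "\<And>z. (\<Sum>l\<le>card S. c l * z ^ l) = (\<Prod>m\<in>S. z - x m)"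
      and cle: "(\<Sum>l\<le>card S. \<bar>c l\<bar>) \<le> (\<Prod>m\<in>S. 1 + \<bar>x m\<bar>)" by blast
    let ?n = "card S"
    \<comment> \<open>\<open>f\<close> holds the coefficients of z times the old product, shifted by
      one place, and \<open>g\<close> those of \<open>x a\<close> times it. Zeros pad both to the
      new degree.\<close>
    define f g where "f = (\<lambda>l. if l = 0 then 0 else c (l - 1))"
      and "g = (\<lambda>l. if l = Suc ?n then 0 else x a * c l)"
    \<comment> \<open>The function \<open>h\<close> is generic so that one reindexing serves both
      the value at z and the sum of absolute values.\<close>
    have shift: "(\<Sum>l\<le>Suc ?n. h (f l) l) = h 0 0 + (\<Sum>l\<le>?n. h (c l) (Suc l))"
      for h :: "real \<Rightarrow> nat \<Rightarrow> real"
      by (subst sum.atMost_Suc_shift) (simp add: f_def)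
    have "(\<Sum>l\<le>Suc ?n. (f l - g l) * z ^ l) = (z - x a) * (\<Prod>m\<in>S. z - x m)" for z
    proof -
      have "(\<Sum>l\<le>Suc ?n. g l * z ^ l) = x a * (\<Sum>l\<le>?n. c l * z ^ l)"
        by (simp add: g_def sum_distrib_left mult.assoc)
      moreover have "(\<Sum>l\<le>Suc ?n. f l * z ^ l) = z * (\<Sum>l\<le>?n. c l * z ^ l)"
        by (subst shift[of "\<lambda>y l. y * z ^ l"]) (simp add: sum_distrib_left mult.left_commute)
      ultimately show ?thesis
        unfolding left_diff_distrib sum_subtractf c by simp
    qed
    moreover have "(\<Sum>l\<le>Suc ?n. \<bar>f l - g l\<bar>) \<le> (1 + \<bar>x a\<bar>) * (\<Prod>m\<in>S. 1 + \<bar>x m\<bar>)"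
    proof -
      have "(\<Sum>l\<le>Suc ?n. \<bar>f l - g l\<bar>) \<le> (\<Sum>l\<le>Suc ?n. \<bar>f l\<bar> + \<bar>g l\<bar>)"
        by (intro sum_mono) auto
      also have "\<dots> = (1 + \<bar>x a\<bar>) * (\<Sum>l\<le>?n. \<bar>c l\<bar>)"
        unfolding sum.distrib shift[of "\<lambda>y l. \<bar>y\<bar>"]
        by (simp add: g_def sum_distrib_left abs_mult distrib_right)
      also have "\<dots> \<le> (1 + \<bar>x a\<bar>) * (\<Prod>m\<in>S. 1 + \<bar>x m\<bar>)"
        using cle by (intro mult_left_mono) auto
      finally show ?thesis .
    qed
    ultimately show ?case using insert(1,2)
      by (intro exI[of _ "\<lambda>l. f l - g l"]) (simp del: sum.atMost_Suc)
  qed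
  thus thesis using that by blast
qed

text \<open>Testing the moments against the coefficients of \<open>\<Prod>m\<noteq>j. (z - x m)\<close>, which vanishes at all
  nodes but \<open>x j\<close>, isolates the coordinate \<open>u j\<close>.\<close>

lemma vandermonde_coordinate_bound:
  fixes x u :: "nat \<Rightarrow> real"
  assumes j: "j \<le> n" and W: "\<And>l. l \<le> n \<Longrightarrow> \<bar>\<Sum>m\<le>n. u m * x m ^ l\<bar> \<le> W"
  shows "\<bar>u j\<bar> * (\<Prod>m\<in>{..n} - {j}. \<bar>x j - x m\<bar>) \<le> W * (\<Prod>m\<in>{..n} - {j}. 1 + \<bar>x m\<bar>)"
proof -
  let ?S = "{..n} - {j}"
  have card: "card ?S = n" using j by simp
  obtain c where c: "\<And>z. (\<Sum>l\<le>n. c l * z ^ l) = (\<Prod>m\<in>?S. z - x m)"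
    and cle: "(\<Sum>l\<le>n. \<bar>c l\<bar>) \<le> (\<Prod>m\<in>?S. 1 + \<bar>x m\<bar>)"
    using prod_linear_coeffs[of ?S x] unfolding card by auto
  have "(\<Sum>l\<le>n. c l * (\<Sum>m\<le>n. u m * x m ^ l)) = (\<Sum>m\<le>n. u m * (\<Sum>l\<le>n. c l * x m ^ l))"
    unfolding sum_distrib_left by (subst sum.swap) (simp add: mult.left_commute)
  also have "\<dots> = (\<Sum>m\<le>n. u m * (\<Prod>k\<in>?S. x m - x k))" by (simp only: c)
  also have "\<dots> = (\<Sum>m\<le>n. if m = j then u j * (\<Prod>k\<in>?S. x j - x k) else 0)"
    by (intro sum.cong refl) (auto simp: prod_zero_iff)
  also have "\<dots> = u j * (\<Prod>k\<in>?S. x j - x k)" using j by simp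
  finally have "\<bar>u j\<bar> * (\<Prod>m\<in>?S. \<bar>x j - x m\<bar>) = \<bar>\<Sum>l\<le>n. c l * (\<Sum>m\<le>n. u m * x m ^ l)\<bar>"
    by (simp add: abs_mult abs_prod)
  also have "\<dots> \<le> (\<Sum>l\<le>n. \<bar>c l\<bar> * W)"
    by (intro order_trans[OF sum_abs] sum_mono) (auto simp: abs_mult intro!: mult_left_mono W)
  also have "\<dots> = W * (\<Sum>l\<le>n. \<bar>c l\<bar>)" by (simp add: sum_distrib_left mult.commute)
  also have "\<dots> \<le> W * (\<Prod>m\<in>?S. 1 + \<bar>x m\<bar>)"
    using W[of 0] by (intro mult_left_mono cle) auto
  finally show ?thesis .
qed

text \<open>The derivative of exp is at least exp (- a) on the half-line from - a onwards; the
  factorisation e^z (e^(y - z) - 1) together with e^x \<ge> 1 + x replaces the mean value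
  theorem.\<close>

lemma exp_diff_ge:
  fixes y z a :: real
  assumes "- a \<le> y" "- a \<le> z"
  shows "exp (- a) * \<bar>y - z\<bar> \<le> \<bar>exp y - exp z\<bar>"
proof -
  have *: "exp (- a) * (y - z) \<le> exp y - exp z" if "- a \<le> z" "z \<le> y" for y z :: real
  proof -
    have "exp (- a) * (y - z) \<le> exp z * (exp (y - z) - 1)"
    proof (rule mult_mono)
      show "y - z \<le> exp (y - z) - 1" using exp_ge_add_one_self[of "y - z"] by linarith
    qed (use that in auto)
    also have "\<dots> = exp y - exp z" by (simp add: right_diff_distrib exp_add[symmetric])
    finally show ?thesis .
  qed
  show ?thesis
    using *[of z y] *[of y z] assms by (cases "z \<le> y") auto
qed

text \<open>The exponents of the nodes are equally spaced in [-a, a] with a = \<delta> n / 2. Each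
  of the n factors therefore costs at most 2 e^a in the coefficient product and gains at least
  e^(-a) \<delta> |j - m| in the node differences. The quotient is 2 e^(2a) / \<delta> per factor,
  with the distances collected into factorials.\<close>

lemma exponential_vandermonde_coordinate_bound:
  fixes \<delta> W :: real and u :: "nat \<Rightarrow> real"
  assumes \<delta>: "0 < \<delta>" and j: "j \<le> n"
    and W: "\<And>l. l \<le> n \<Longrightarrow> \<bar>\<Sum>m\<le>n. u m * exp (\<delta> * (real n / 2 - real m)) ^ l\<bar> \<le> W"
  shows "\<bar>u j\<bar> \<le> W * (2 * exp (\<delta> * real n) / \<delta>) ^ n / (fact j * fact (n - j))"
proof -
  define a where "a = \<delta> * real n / 2"
  define y where "y = (\<lambda>m. \<delta> * (real n / 2 - real m))"
  let ?S = "{..n} - {j}"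
  have card: "card ?S = n" using j by simp
  have y: "- a \<le> y m" "y m \<le> a" if "m \<le> n" for m
  proof -
    have "\<delta> * real m \<le> \<delta> * real n" using that \<delta> by simp
    thus "- a \<le> y m" unfolding a_def y_def by (simp add: algebra_simps)
    show "y m \<le> a" unfolding a_def y_def using \<delta> by (simp add: algebra_simps)
  qed
  have a: "0 \<le> a" unfolding a_def using \<delta> by simp
  have W0: "0 \<le> W" using W[of 0] by linarith
  have fpos: "0 < (fact j * fact (n - j) :: real)" by simp
  have "(exp (- a) * \<delta>) ^ n * (fact j * fact (n - j)) = (\<Prod>m\<in>?S. exp (- a) * \<bar>y j - y m\<bar>)"
  proof -
    have "(\<Prod>m\<in>?S. exp (- a) * \<bar>y j - y m\<bar>) = (\<Prod>m\<in>?S. (exp (- a) * \<delta>) * \<bar>real j - real m\<bar>)"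
    proof (intro prod.cong refl)
      fix m
      have "y j - y m = \<delta> * (real m - real j)" unfolding y_def by (simp add: algebra_simps)
      thus "exp (- a) * \<bar>y j - y m\<bar> = (exp (- a) * \<delta>) * \<bar>real j - real m\<bar>"
        using \<delta> by (simp add: abs_mult abs_minus_commute)
    qed
    also have "\<dots> = (exp (- a) * \<delta>) ^ n * (fact j * fact (n - j))"
      unfolding prod.distrib prod_constant card prod_diff_fact[OF j]
      by (simp add: power_mult_distrib)
    finally show ?thesis ..
  qed
  also have "\<dots> \<le> (\<Prod>m\<in>?S. \<bar>exp (y j) - exp (y m)\<bar>)"
    using y j by (intro prod_mono) (auto intro!: exp_diff_ge)
  finally have "\<bar>u j\<bar> * ((exp (- a) * \<delta>) ^ n * (fact j * fact (n - j)))
      \<le> \<bar>u j\<bar> * (\<Prod>m\<in>?S. \<bar>exp (y j) - exp (y m)\<bar>)"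
    by (intro mult_left_mono) auto
  also have "\<dots> \<le> W * (\<Prod>m\<in>?S. 1 + \<bar>exp (y m)\<bar>)"
    using W by (intro vandermonde_coordinate_bound[OF j]) (simp add: y_def)
  also have "\<dots> \<le> W * (\<Prod>m\<in>?S. 2 * exp a)"
  proof (intro mult_left_mono prod_mono W0)
    fix m assume "m \<in> ?S"
    hence "exp (y m) \<le> exp a" using y[of m] by simp
    moreover have "1 \<le> exp a" using a by simp
    ultimately show "0 \<le> 1 + \<bar>exp (y m)\<bar> \<and> 1 + \<bar>exp (y m)\<bar> \<le> 2 * exp a"
      by (simp only: abs_exp_cancel) (use exp_ge_zero[of "y m"] in linarith)
  qed
  also have "\<dots> = W * (2 * exp a) ^ n" using card by simp
  finally have "\<bar>u j\<bar> * (fact j * fact (n - j)) * (exp (- a) * \<delta>) ^ n \<le> W * (2 * exp a) ^ n"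
    by (simp add: ac_simps)
  hence "\<bar>u j\<bar> * (fact j * fact (n - j)) \<le> W * (2 * exp a) ^ n / (exp (- a) * \<delta>) ^ n"
    using \<delta> by (subst pos_le_divide_eq) auto
  also have "\<dots> = W * (2 * exp (\<delta> * real n) / \<delta>) ^ n"
  proof -
    have "exp (\<delta> * real n) = exp a * exp a" unfolding exp_add[symmetric] a_def by simp
    hence "2 * exp a / (exp (- a) * \<delta>) = 2 * exp (\<delta> * real n) / \<delta>"
      by (simp add: exp_minus field_simps)
    thus ?thesis by (metis power_divide times_divide_eq_right)
  qed
  finally show ?thesis using fpos by (subst pos_le_divide_eq) auto
qed

text \<open>The summands are squares of binomial coefficients divided by (n!)^2. Their numerators
  add up to the central binomial coefficient, at most 4^n, and n! \<ge> (n / e)^n.\<close>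

lemma sum_inverse_fact_square_le:
  assumes "0 < n"
  shows "(\<Sum>j\<le>n. (1 / (fact j * fact (n - j) :: real))\<^sup>2) \<le> ((2 * exp 1 / real n) ^ n)\<^sup>2"
proof -
  have "(\<Sum>j\<le>n. (1 / (fact j * fact (n - j) :: real))\<^sup>2) = (\<Sum>j\<le>n. real (n choose j) ^ 2 / (fact n)\<^sup>2)"
    by (intro sum.cong refl) (simp add: binomial_fact power_divide)
  also have "\<dots> = real (\<Sum>j\<le>n. (n choose j)\<^sup>2) / (fact n)\<^sup>2"
    by (simp add: sum_divide_distrib)
  also have "\<dots> = real ((2 * n) choose n) / (fact n)\<^sup>2" by (simp only: choose_square_sum)
  also have "\<dots> \<le> 2 ^ (2 * n) / (fact n)\<^sup>2"
    using of_nat_mono[OF binomial_le_pow2[of "2 * n" n], where 'a = real]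
    by (intro divide_right_mono) simp_all
  also have "\<dots> = (2 ^ n / fact n)\<^sup>2" by (simp add: power_divide power_mult[symmetric] mult.commute)
  also have "\<dots> \<le> ((2 * exp 1 / real n) ^ n)\<^sup>2"
  proof (rule power_mono)
    show "2 ^ n / fact n \<le> (2 * exp 1 / real n) ^ n"
      using power_self_le_fact_exp[of n] assms
      by (simp add: power_divide power_mult_distrib field_simps)
  qed auto
  finally show ?thesis .
qed

text \<open>The Euclidean norm \<open>W\<close> of the moment vector dominates every moment, so the
  coordinate bounds can be squared and summed. The constant is the product of 2 e^(\<delta> n) /
  \<delta> and 2 e / n.\<close>

lemma exponential_vandermonde_lower_bound:
  fixes \<delta> :: real and u :: "nat \<Rightarrow> real"
  assumes \<delta>: "0 < \<delta>" and n: "0 < n"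
  shows "(\<Sum>j\<le>n. (u j)\<^sup>2)
    \<le> ((4 * exp 1 * exp (\<delta> * real n) / (\<delta> * real n)) ^ n)\<^sup>2
        * (\<Sum>l\<le>n. (\<Sum>m\<le>n. u m * exp (\<delta> * (real n / 2 - real m)) ^ l)\<^sup>2)"
proof -
  define w where "w = (\<lambda>l. \<Sum>m\<le>n. u m * exp (\<delta> * (real n / 2 - real m)) ^ l)"
  define W where "W = sqrt (\<Sum>l\<le>n. (w l)\<^sup>2)"
  have WW: "W\<^sup>2 = (\<Sum>l\<le>n. (w l)\<^sup>2)" unfolding W_def by (simp add: sum_nonneg)
  have w: "\<bar>w l\<bar> \<le> W" if "l \<le> n" for l
  proof -
    have "(w l)\<^sup>2 \<le> (\<Sum>l\<le>n. (w l)\<^sup>2)" using that by (intro member_le_sum) auto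
    thus ?thesis unfolding W_def by (metis real_sqrt_abs real_sqrt_le_mono)
  qed
  let ?c = "(2 * exp (\<delta> * real n) / \<delta>) ^ n"
  have "(\<Sum>j\<le>n. (u j)\<^sup>2) \<le> (\<Sum>j\<le>n. (W * ?c)\<^sup>2 * (1 / (fact j * fact (n - j)))\<^sup>2)"
  proof (rule sum_mono)
    fix j assume "j \<in> {..n}"
    hence "\<bar>u j\<bar> \<le> W * ?c / (fact j * fact (n - j))"
      using exponential_vandermonde_coordinate_bound[OF \<delta>, of j n u W] w by (auto simp: w_def)
    hence "\<bar>u j\<bar>\<^sup>2 \<le> (W * ?c / (fact j * fact (n - j)))\<^sup>2" by (intro power_mono) auto
    thus "(u j)\<^sup>2 \<le> (W * ?c)\<^sup>2 * (1 / (fact j * fact (n - j)))\<^sup>2"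
      by (simp add: power_divide power_mult_distrib)
  qed
  also have "\<dots> \<le> (W * ?c)\<^sup>2 * ((2 * exp 1 / real n) ^ n)\<^sup>2"
    unfolding sum_distrib_left[symmetric]
    by (intro mult_left_mono sum_inverse_fact_square_le n) auto
  also have "\<dots> = (?c * (2 * exp 1 / real n) ^ n)\<^sup>2 * W\<^sup>2" by (simp add: power_mult_distrib)
  also have "?c * (2 * exp 1 / real n) ^ n = (4 * exp 1 * exp (\<delta> * real n) / (\<delta> * real n)) ^ n"
    unfolding power_mult_distrib[symmetric] by (simp add: mult_ac)
  finally show ?thesis unfolding WW w_def by (simp add: mult.commute)
qed

section \<open>Sampled exponentials\<close>

text \<open>Within the group of rows k + l q, the dependence on l is the l-th power of a node.
  Absorbing row k into the unknowns thus leaves a square Vandermonde system. By \<open>qN\<close>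
  the q groups fit into the available rows without overlap, so their estimates add up.\<close>

lemma sampled_exponentials_lower_bound:
  fixes \<beta> \<mu> :: real and v :: "nat \<Rightarrow> real"
  assumes \<beta>: "0 < \<beta>" and \<mu>: "0 < \<mu>" and n: "0 < n" and N: "0 < N"
    and q: "0 < q" and qN: "q * (n + 1) \<le> N + 1"
  shows "real q * (\<Sum>m\<le>n. (v m)\<^sup>2)
    \<le> (exp (2 * \<beta> * \<mu>) * (2 * exp 1 * real N / (\<beta> * \<mu> * real q)) ^ n)\<^sup>2
      * (\<Sum>i\<le>N. (\<Sum>m\<le>n. exp (- (\<beta> / real N * real i) * (- \<mu> + 2 * \<mu> / real n * real m)) * v m)\<^sup>2)"
proof -
  define h where "h = \<beta> / real N"
  define t where "t = (\<lambda>m. - \<mu> + 2 * \<mu> / real n * real m)"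
  define F where "F = (\<lambda>i. \<Sum>m\<le>n. exp (- (h * real i) * t m) * v m)"
  \<comment> \<open>Row spacing within a group, h q, times the spacing 2 \<mu> / n of the t-grid:
    the gap between neighbouring node exponents.\<close>
  define \<delta> where "\<delta> = h * real q * (2 * \<mu> / real n)"
  define G where "G = (4 * exp 1 * exp (\<delta> * real n) / (\<delta> * real n)) ^ n"
  \<comment> \<open>Largest loss in undoing the scaling by row k, in squared form: k \<le> q - 1 and
    t \<le> \<mu>.\<close>
  define D where "D = exp (2 * h * \<mu> * (real q - 1))"
  have h: "0 < h" unfolding h_def using \<beta> N by simp
  have \<delta>: "0 < \<delta>" unfolding \<delta>_def using h q \<mu> n by simp
  have node: "\<delta> * (real n / 2 - real m) = - (h * real q) * t m" for m
    unfolding \<delta>_def t_def using n by (simp add: field_simps)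
  have group: "(\<Sum>m\<le>n. (v m)\<^sup>2) \<le> D * G\<^sup>2 * (\<Sum>l\<le>n. (F (k + l * q))\<^sup>2)" if k: "k < q" for k
  proof -
    define u where "u = (\<lambda>m. exp (- (h * real k) * t m) * v m)"
    have moment: "(\<Sum>m\<le>n. u m * exp (\<delta> * (real n / 2 - real m)) ^ l) = F (k + l * q)" for l
    proof -
      have "u m * exp (\<delta> * (real n / 2 - real m)) ^ l = exp (- (h * real (k + l * q)) * t m) * v m" for m
      proof -
        have "- (h * real (k + l * q)) * t m = - (h * real k) * t m + real l * (- (h * real q) * t m)"
          by (simp add: algebra_simps)
        thus ?thesis unfolding node u_def by (simp only: exp_add exp_of_nat_mult) simp
      qed
      thus ?thesis unfolding F_def by simp
    qed
    have "(v m)\<^sup>2 \<le> D * (u m)\<^sup>2" if m: "m \<le> n" for m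
    proof -
      have "t m \<le> \<mu>"
      proof -
        have "2 * \<mu> * real m \<le> 2 * \<mu> * real n" using m \<mu> by simp
        thus ?thesis unfolding t_def using n by (simp add: field_simps)
      qed
      hence "real k * t m \<le> real k * \<mu>" by (intro mult_left_mono) auto
      also have "\<dots> \<le> (real q - 1) * \<mu>" using k \<mu> by (intro mult_right_mono) auto
      finally have "h * (real k * t m) \<le> h * ((real q - 1) * \<mu>)" using h by simp
      hence "0 \<le> 2 * h * \<mu> * (real q - 1) + 2 * (- (h * real k) * t m)" by (simp add: algebra_simps)
      hence "1 \<le> exp (2 * h * \<mu> * (real q - 1) + 2 * (- (h * real k) * t m))"
        by (simp only: one_le_exp_iff)
      also have "\<dots> = D * (exp (- (h * real k) * t m))\<^sup>2"
        unfolding D_def exp_add exp_double ..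
      finally have "1 * (v m)\<^sup>2 \<le> D * (exp (- (h * real k) * t m))\<^sup>2 * (v m)\<^sup>2"
        by (intro mult_right_mono) auto
      thus ?thesis unfolding u_def by (simp add: power_mult_distrib mult.assoc)
    qed
    hence "(\<Sum>m\<le>n. (v m)\<^sup>2) \<le> D * (\<Sum>m\<le>n. (u m)\<^sup>2)"
      unfolding sum_distrib_left by (intro sum_mono) auto
    also have "\<dots> \<le> D * (G\<^sup>2 * (\<Sum>l\<le>n. (\<Sum>m\<le>n. u m * exp (\<delta> * (real n / 2 - real m)) ^ l)\<^sup>2))"
      unfolding G_def D_def
      by (intro mult_left_mono exponential_vandermonde_lower_bound \<delta> n) auto
    finally show ?thesis unfolding moment by (simp add: mult.assoc)
  qed
  have "real q * (\<Sum>m\<le>n. (v m)\<^sup>2) = (\<Sum>k<q. \<Sum>m\<le>n. (v m)\<^sup>2)" by simp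
  also have "\<dots> \<le> (\<Sum>k<q. D * G\<^sup>2 * (\<Sum>l\<le>n. (F (k + l * q))\<^sup>2))"
    using group by (intro sum_mono) auto
  also have "\<dots> = D * G\<^sup>2 * (\<Sum>l<Suc n. \<Sum>k<q. (F (k + l * q))\<^sup>2)"
    unfolding sum_distrib_left[symmetric] lessThan_Suc_atMost by (subst sum.swap) simp
  \<comment> \<open>The indices k + l q with k < q and l \<le> n enumerate every number below (n +
    1) q exactly once.\<close>
  also have "(\<Sum>l<Suc n. \<Sum>k<q. (F (k + l * q))\<^sup>2) = (\<Sum>i<Suc n * q. (F i)\<^sup>2)"
  proof -
    have "(\<Sum>k<q. (F (k + l * q))\<^sup>2) = (\<Sum>i\<in>{l * q..<l * q + q}. (F i)\<^sup>2)" for l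
      using sum.shift_bounds_nat_ivl[of "\<lambda>i. (F i)\<^sup>2" 0 "l * q" q]
      by (simp only: atLeast0LessThan add_0_left add.commute[of q])
    thus ?thesis by (simp only: sum.nat_group)
  qed
  also have "D * G\<^sup>2 * (\<Sum>i<Suc n * q. (F i)\<^sup>2) \<le> D * G\<^sup>2 * (\<Sum>i\<le>N. (F i)\<^sup>2)"
    using qN by (intro mult_left_mono sum_mono2) (auto simp: D_def algebra_simps)
  also have "\<dots> \<le> (exp (2 * \<beta> * \<mu>) * (2 * exp 1 * real N / (\<beta> * \<mu> * real q)) ^ n)\<^sup>2 * (\<Sum>i\<le>N. (F i)\<^sup>2)"
  proof (intro mult_right_mono sum_nonneg)
    have \<delta>n: "\<delta> * real n = 2 * \<beta> * \<mu> * real q / real N"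
      unfolding \<delta>_def h_def using n by simp
    have G: "G = exp (\<delta> * real n * real n) * (2 * exp 1 * real N / (\<beta> * \<mu> * real q)) ^ n"
    proof -
      have "4 * exp 1 * exp (\<delta> * real n) / (\<delta> * real n)
          = exp (\<delta> * real n) * (2 * exp 1 * real N / (\<beta> * \<mu> * real q))"
        unfolding \<delta>n using \<beta> \<mu> q N by (simp add: field_simps)
      moreover have "exp (\<delta> * real n * real n) = exp (\<delta> * real n) ^ n"
        using exp_of_nat_mult[of n "\<delta> * real n"] by (simp only: mult.commute[of "real n"])
      ultimately show ?thesis by (simp only: G_def power_mult_distrib)
    qed
    have "real (q * (n + 1)) \<le> real (N + 1)" using qN by (simp only: of_nat_le_iff)
    \<comment> \<open>Doubling the hypothesis bounds the left side by 2 N + 1 - q, and q \<ge> 1.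
      This is what fits \<open>D\<close> and the exponential part of G^2 together into the square of
      exp (2 \<beta> \<mu>).\<close>
    hence "(real q - 1) + 2 * real q * real n \<le> 2 * real N" using q by (simp add: algebra_simps)
    hence "2 * \<beta> * \<mu> / real N * ((real q - 1) + 2 * real q * real n)
        \<le> 2 * \<beta> * \<mu> / real N * (2 * real N)"
      using \<beta> \<mu> by (intro mult_left_mono) auto
    hence "2 * h * \<mu> * (real q - 1) + 2 * (\<delta> * real n * real n) \<le> 2 * (2 * \<beta> * \<mu>)"
      unfolding \<delta>n unfolding h_def using N by (simp add: field_simps)
    hence "D * (exp (\<delta> * real n * real n))\<^sup>2 \<le> (exp (2 * \<beta> * \<mu>))\<^sup>2"
      unfolding D_def exp_double[symmetric] exp_add[symmetric] by (simp only: exp_le_cancel_iff)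
    thus "D * G\<^sup>2 \<le> (exp (2 * \<beta> * \<mu>) * (2 * exp 1 * real N / (\<beta> * \<mu> * real q)) ^ n)\<^sup>2"
      unfolding G power_mult_distrib mult.assoc[symmetric] by (intro mult_right_mono) auto
  qed auto
  finally show ?thesis unfolding F_def h_def t_def .
qed

lemma one_minus_exp_power_square_le:
  fixes y :: real
  assumes "0 \<le> y"
  shows "((1 - exp (- y)) ^ n)\<^sup>2 \<le> (y ^ n)\<^sup>2"
proof -
  have "1 - exp (- y) \<le> y" using exp_ge_add_one_self[of "- y"] by linarith
  thus ?thesis using assms by (intro power_mono) auto
qed

theorem theorem3p1:
  fixes \<beta> \<mu> h_s h_t :: real
    and n_s n_t :: nat
    and s t :: "nat \<Rightarrow> real"
    and R :: "real mat"
    and q :: int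
  assumes "\<beta> > 0" and "\<mu> > 0"
    and "n_s > 0" and "n_t > 0" and "n_s \<ge> n_t"
    and "h_s = \<beta> / real n_s"
    and "h_t = 2 * \<mu> / real n_t"
    and "\<And>i. i \<le> n_s \<Longrightarrow> s i = h_s * real i"
    and "\<And>j. j \<le> n_t \<Longrightarrow> t j = - \<mu> + h_t * real j"
    and "R = mat (n_s + 1) (n_t + 1) (\<lambda>(i, j). exp (- s i * t j))"
    and "q = \<lfloor>real (n_s + 1) / real (n_t + 1)\<rfloor>"
  shows "1 / (sqrt 2 * real n_t powr (1 / 4)) * (real n_t / (\<beta> * \<mu>)) ^ n_t
           \<le> condition_number R
       \<and> condition_number R
           \<le> sqrt (real ((n_t + 1) * (n_s + 1)) / real_of_int q) * exp (3 * \<beta> * \<mu>)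
               * (2 * exp 1 * real n_s / (\<beta> * \<mu> * real_of_int q)) ^ n_t"
proof -
  note [simp del] = of_nat_Suc of_nat_add

  \<comment> \<open>Grid sizes, entries and norms in coordinates\<close>
  define n N where "n = n_t" and "N = n_s"
  define Q where "Q = (N + 1) div (n + 1)"
  have \<beta>: "0 < \<beta>" and \<mu>: "0 < \<mu>" and n: "0 < n" and N: "0 < N" and nN: "n \<le> N"
    using assms by (auto simp: n_def N_def)
  have qQ: "real_of_int q = real Q"
    unfolding assms(11) Q_def n_def N_def by (simp only: floor_divide_of_nat_eq of_int_of_nat_eq)
  \<comment> \<open>Here n \<le> N enters: it makes the number of row groups positive.\<close>
  have Q: "0 < Q" unfolding Q_def using nN by (simp add: div_greater_zero_iff)
  have QN: "Q * (n + 1) \<le> N + 1" unfolding Q_def by (rule div_times_less_eq_dividend)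
  define x where "x = \<beta> * \<mu>"
  have x: "0 < x" unfolding x_def using \<beta> \<mu> by simp
  have st: "s i * t j = (\<beta> / real N * real i) * (- \<mu> + 2 * \<mu> / real n * real j)"
    if "i \<le> N" "j \<le> n" for i j
    using that assms by (simp add: n_def N_def)
  have stle: "\<bar>s i * t j\<bar> \<le> x" if i: "i \<le> N" and j: "j \<le> n" for i j
  proof -
    have "2 * \<mu> * real j \<le> 2 * \<mu> * real n" using j \<mu> by simp
    hence "- \<mu> + 2 * \<mu> / real n * real j \<le> \<mu>" using n by (simp add: field_simps)
    moreover have "0 \<le> 2 * \<mu> / real n * real j" using \<mu> by simp
    ultimately have "\<bar>- \<mu> + 2 * \<mu> / real n * real j\<bar> \<le> \<mu>" by linarith
    moreover have "\<bar>\<beta> / real N * real i\<bar> \<le> \<beta>" using i \<beta> N by (simp add: field_simps)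
    ultimately show ?thesis unfolding st[OF i j] x_def abs_mult
      using \<beta> by (intro mult_mono) auto
  qed
  have Rc: "R \<in> carrier_mat (N + 1) (n + 1)" unfolding assms(10) n_def N_def by simp
  have Rij: "R $$ (i, j) = exp (- (s i * t j))" if "i \<le> N" "j \<le> n" for i j
    using that unfolding assms(10) n_def N_def by simp
  have norm: "v \<bullet> v = (\<Sum>m\<le>n. (v $ m)\<^sup>2)" if "v \<in> carrier_vec (n + 1)" for v :: "real vec"
    using that by (simp add: scalar_prod_def power2_eq_square atLeast0LessThan lessThan_Suc_atMost)
  have Rv: "(R *\<^sub>v v) $ i = (\<Sum>m\<le>n. exp (- (s i * t m)) * v $ m)"
    if "v \<in> carrier_vec (n + 1)" "i \<le> N" for v i
    using that Rc Rij by (simp add: scalar_prod_def atLeast0LessThan lessThan_Suc_atMost)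
  have RvRv: "(R *\<^sub>v v) \<bullet> (R *\<^sub>v v) = (\<Sum>i\<le>N. (\<Sum>m\<le>n. exp (- (s i * t m)) * v $ m)\<^sup>2)"
    if v: "v \<in> carrier_vec (n + 1)" for v
  proof -
    have "(R *\<^sub>v v) \<bullet> (R *\<^sub>v v) = (\<Sum>i\<le>N. ((R *\<^sub>v v) $ i)\<^sup>2)"
      using Rc by (simp add: scalar_prod_def power2_eq_square atLeast0LessThan lessThan_Suc_atMost
          del: index_mult_mat_vec)
    thus ?thesis using Rv[OF v] by simp
  qed

  \<comment> \<open>Upper bound\<close>
  define E where "E = exp (2 * \<beta> * \<mu>) * (2 * exp 1 * real N / (\<beta> * \<mu> * real Q)) ^ n"
  have E: "0 < E" unfolding E_def using \<beta> \<mu> Q N by simp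
  define l where "l = real Q / E\<^sup>2"
  have l: "0 < l" unfolding l_def using Q E by simp
  have lower: "l * (v \<bullet> v) \<le> (R *\<^sub>v v) \<bullet> (R *\<^sub>v v)" if v: "v \<in> carrier_vec (n + 1)" for v
  proof -
    have "real Q * (v \<bullet> v) \<le> E\<^sup>2 * ((R *\<^sub>v v) \<bullet> (R *\<^sub>v v))"
      unfolding norm[OF v] RvRv[OF v] E_def
      using sampled_exponentials_lower_bound[OF \<beta> \<mu> n N Q QN, of "\<lambda>m. v $ m"]
      by (simp add: st)
    thus ?thesis unfolding l_def using E by (simp add: field_simps)
  qed
  \<comment> \<open>An entry of R^T R is a sum of N + 1 products of two entries of R, each at most
    e^x; the last factor is the dimension in \<open>quadratic_form_le\<close>.\<close>
  define L where "L = real (N + 1) * (exp x)\<^sup>2 * real (n + 1)"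
  have upper: "(R *\<^sub>v v) \<bullet> (R *\<^sub>v v) \<le> L * (v \<bullet> v)" if v: "v \<in> carrier_vec (n + 1)" for v
  proof -
    have "\<bar>(transpose_mat R * R) $$ (i, j)\<bar> \<le> real (N + 1) * (exp x)\<^sup>2"
      if ij: "i < n + 1" "j < n + 1" for i j
    proof -
      have "(transpose_mat R * R) $$ (i, j) = (\<Sum>k\<le>N. R $$ (k, i) * R $$ (k, j))"
        using ij Rc by (simp add: scalar_prod_def atLeast0LessThan lessThan_Suc_atMost)
      also have "\<bar>\<dots>\<bar> \<le> (\<Sum>k\<le>N. (exp x)\<^sup>2)"
      proof (intro order_trans[OF sum_abs] sum_mono)
        fix k assume k: "k \<in> {..N}"
        have "\<bar>R $$ (k, j)\<bar> \<le> exp x" if "j < n + 1" for j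
          using stle[of k j] k that by (simp add: Rij abs_le_iff)
        hence "\<bar>R $$ (k, i)\<bar> * \<bar>R $$ (k, j)\<bar> \<le> exp x * exp x"
          using ij by (intro mult_mono) auto
        thus "\<bar>R $$ (k, i) * R $$ (k, j)\<bar> \<le> (exp x)\<^sup>2" by (simp add: abs_mult power2_eq_square)
      qed
      finally show ?thesis by simp
    qed
    from quadratic_form_le[OF _ v this] show ?thesis
      using Rc unfolding gram_quadratic_form[OF Rc v] L_def by simp
  qed
  have n1: "0 < n + 1" by simp
  have "condition_number R \<le> sqrt (L / l)"
    by (rule condition_number_le[OF Rc n1 l lower upper])
  also have "L / l = (real ((n + 1) * (N + 1)) / real Q) * (exp x * E)\<^sup>2"
    unfolding L_def l_def of_nat_mult by (simp add: power_mult_distrib)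
  also have "sqrt \<dots> = sqrt (real ((n + 1) * (N + 1)) / real Q) * (exp x * E)"
    unfolding real_sqrt_mult using E by simp
  also have "\<dots> = sqrt (real ((n + 1) * (N + 1)) / real Q) * exp (3 * \<beta> * \<mu>)
      * (2 * exp 1 * real N / (\<beta> * \<mu> * real Q)) ^ n"
  proof -
    have "exp (3 * \<beta> * \<mu>) = exp x * exp (2 * \<beta> * \<mu>)"
      unfolding exp_add[symmetric] x_def by simp
    thus ?thesis unfolding E_def by simp
  qed
  finally have first: "condition_number R
      \<le> sqrt (real ((n + 1) * (N + 1)) / real Q) * exp (3 * \<beta> * \<mu>)
        * (2 * exp 1 * real N / (\<beta> * \<mu> * real Q)) ^ n" .

  \<comment> \<open>Lower bound\<close>
  define e where "e = (unit_vec (n + 1) 0 :: real vec)"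
  define w where "w = vec (n + 1) (\<lambda>j. (- 1) ^ j * real (n choose j))"
  define b where "b = (\<Sum>i\<le>N. (exp (- (s i * t 0)))\<^sup>2)"
  define C where "C = real ((2 * n) choose n)"
  \<comment> \<open>Upper bound for the Rayleigh quotient at \<open>w\<close>. Since
    \<open>b\<close> is the Rayleigh quotient at \<open>e\<close>, the column norm cancels in b / a
    and leaves C (n / (2x))^(2n).\<close>
  define a where "a = ((2 * x / real n) ^ n)\<^sup>2 * b / C"
  have ec: "e \<in> carrier_vec (n + 1)" and wc: "w \<in> carrier_vec (n + 1)"
    unfolding e_def w_def by auto
  have ee: "e \<bullet> e = 1" unfolding e_def by simp
  have C: "0 < C" unfolding C_def by simp
  have b: "0 < b" unfolding b_def by (intro sum_pos) auto
  have a: "0 < a" unfolding a_def using x n b C by simp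
  have ww: "w \<bullet> w = C"
  proof -
    have "w \<bullet> w = (\<Sum>m\<le>n. real ((n choose m)\<^sup>2))"
      unfolding norm[OF wc] by (intro sum.cong refl) (simp add: w_def power_mult_distrib flip: power_mult)
    thus ?thesis unfolding C_def choose_square_sum[symmetric] by simp
  qed
  have Re: "(R *\<^sub>v e) \<bullet> (R *\<^sub>v e) = b"
  proof -
    have "(\<Sum>m\<le>n. exp (- (s i * t m)) * e $ m) = exp (- (s i * t 0))" for i
    proof -
      have "(\<Sum>m\<le>n. exp (- (s i * t m)) * e $ m) = (\<Sum>m\<le>n. if m = 0 then exp (- (s i * t 0)) else 0)"
        by (intro sum.cong refl) (auto simp: e_def)
      thus ?thesis by simp
    qed
    thus ?thesis unfolding RvRv[OF ec] b_def by simp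
  qed
  have Rw: "(R *\<^sub>v w) \<bullet> (R *\<^sub>v w) \<le> a * (w \<bullet> w)"
  proof -
    have "(\<Sum>m\<le>n. exp (- (s i * t m)) * w $ m)\<^sup>2
        \<le> ((2 * x / real n) ^ n)\<^sup>2 * (exp (- (s i * t 0)))\<^sup>2" if i: "i \<le> N" for i
    proof -
      \<comment> \<open>Here y = s_i h_t: along row i the entries form a geometric progression with
        ratio e^(-y).\<close>
      define y where "y = \<beta> / real N * real i * (2 * \<mu> / real n)"
      have y0: "0 \<le> y" unfolding y_def using \<beta> \<mu> by simp
      have yle: "y \<le> 2 * x / real n"
      proof -
        have "\<beta> / real N * real i \<le> \<beta>" using i \<beta> N by (simp add: field_simps)
        hence "y \<le> \<beta> * (2 * \<mu> / real n)" unfolding y_def using \<mu> by (intro mult_right_mono) auto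
        thus ?thesis by (simp add: x_def mult.left_commute)
      qed
      \<comment> \<open>The signs of \<open>w\<close> are merged into the powers and a factor 1 is
        inserted, giving the binomial expansion of (1 - e^(-y))^n.\<close>
      have "(\<Sum>m\<le>n. exp (- (s i * t m)) * w $ m)
          = (\<Sum>m\<le>n. exp (- (s i * t 0)) * (real (n choose m) * (- exp (- y)) ^ m * 1 ^ (n - m)))"
      proof (intro sum.cong refl)
        fix m assume m: "m \<in> {..n}"
        have "- (s i * t m) = - (s i * t 0) + real m * (- y)"
          using m i by (simp add: st y_def algebra_simps)
        hence "exp (- (s i * t m)) = exp (- (s i * t 0)) * exp (- y) ^ m"
          by (simp only: exp_add exp_of_nat_mult)
        moreover have "(- exp (- y)) ^ m = (- 1) ^ m * exp (- y) ^ m"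
          by (simp flip: power_mult_distrib)
        ultimately show "exp (- (s i * t m)) * w $ m
            = exp (- (s i * t 0)) * (real (n choose m) * (- exp (- y)) ^ m * 1 ^ (n - m))"
          using m by (simp add: w_def)
      qed
      also have "\<dots> = exp (- (s i * t 0)) * (1 - exp (- y)) ^ n"
        unfolding sum_distrib_left[symmetric] binomial_ring[symmetric] by simp
      also have "(\<dots>)\<^sup>2 = ((1 - exp (- y)) ^ n)\<^sup>2 * (exp (- (s i * t 0)))\<^sup>2"
        by (simp add: power_mult_distrib)
      also have "\<dots> \<le> ((2 * x / real n) ^ n)\<^sup>2 * (exp (- (s i * t 0)))\<^sup>2"
      proof (rule mult_right_mono)
        have "(y ^ n)\<^sup>2 \<le> ((2 * x / real n) ^ n)\<^sup>2" using y0 yle by (intro power_mono) auto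
        with one_minus_exp_power_square_le[OF y0, of n]
        show "((1 - exp (- y)) ^ n)\<^sup>2 \<le> ((2 * x / real n) ^ n)\<^sup>2" by linarith
      qed auto
      finally show ?thesis .
    qed
    hence "(R *\<^sub>v w) \<bullet> (R *\<^sub>v w) \<le> ((2 * x / real n) ^ n)\<^sup>2 * b"
      unfolding RvRv[OF wc] b_def sum_distrib_left by (intro sum_mono) auto
    thus ?thesis unfolding ww a_def using C by simp
  qed
  have "1 / (sqrt 2 * real n powr (1 / 4)) * (real n / x) ^ n \<le> sqrt (b / a)"
  proof (rule real_le_rsqrt)
    have "(1 / (sqrt 2 * real n powr (1 / 4)) * (real n / x) ^ n)\<^sup>2
        = 1 / (2 * sqrt (real n)) * ((real n / x) ^ n)\<^sup>2"
    proof -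
      have "(real n powr (1 / 4))\<^sup>2 = sqrt (real n)"
        using n by (simp add: power2_eq_square powr_add[symmetric] powr_half_sqrt)
      thus ?thesis by (simp add: power_mult_distrib power_divide)
    qed
    \<comment> \<open>Replacing x by 2x costs 4^n after squaring, which exposes exactly the lower
      bound for the central binomial coefficient.\<close>
    also have "\<dots> = 4 ^ n / (2 * sqrt (real n)) * ((real n / (2 * x)) ^ n)\<^sup>2"
    proof -
      have "(4::real) ^ n = (2 ^ n)\<^sup>2" by (simp add: power2_eq_square flip: power_mult_distrib)
      moreover have "(real n / x) ^ n = 2 ^ n * (real n / (2 * x)) ^ n"
        by (simp flip: power_mult_distrib)
      ultimately show ?thesis by (simp add: power_mult_distrib)
    qed
    also have "\<dots> \<le> C * ((real n / (2 * x)) ^ n)\<^sup>2"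
      unfolding C_def by (intro mult_right_mono central_binomial_ge n) auto
    also have "\<dots> = b / a"
      unfolding a_def using b C x n by (simp add: field_simps power_divide)
    finally show "(1 / (sqrt 2 * real n powr (1 / 4)) * (real n / x) ^ n)\<^sup>2 \<le> b / a" .
  qed
  also have "\<dots> \<le> condition_number R"
    by (rule condition_number_ge[OF Rc n1 l lower ec _ _ _ wc a Rw])
       (use b C in \<open>simp_all add: ee ww Re\<close>)
  finally show ?thesis
    using first unfolding qQ n_def N_def x_def by simp
qed

end
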